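(* For almost every real $y>1$ (with respect to Lebesgue measure), for every integer $q\ge1$ and every integer $0\le r<q$, $$\#\{1\le k\le K\mid\lfloor y^k\rfloor\equiv r\pmod q\}=\frac Kq+o_{y,q}(K)$$ as $K\to\infty$.
   Context: $\lfloor x\rfloor$ is the greatest integer not exceeding $x$; $k$ and $K$ are positive integers. $o_{y,q}(K)$ denotes a quantity which, divided by $K$, tends to $0$ as $K\to\infty$ for fixed $y$ and $q$. *)

theory Defs
  imports
    "HOL-Analysis.Analysis"
    "HOL-Library.Landau_Symbols"
    "HOL-Number_Theory.Cong"
begin

end

theory Submission
  imports Defs "HOL-Library.Discrete_Functions"
begin

text \<open>Fix \<open>q\<close> and \<open>r < q\<close>, and let \<open>e\<close> (the function \<open>residue_dev q r\<close> below) be the indicator of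
  \<open>\<lfloor>x\<rfloor> \<equiv> r (mod q)\<close> minus \<open>1/q\<close>. The quantity to be estimated is \<open>S\<^sub>K(y) = \<Sum>k=1..K. e(y^k)\<close>, and the
  theorem says that \<open>S\<^sub>K(y) / K\<close> tends to 0 for almost every \<open>y > 1\<close>. On each interval \<open>[a, b]\<close> with
  \<open>1 < a \<le> b\<close> this follows from the bound \<open>O(K)\<close> for the integral of \<open>S\<^sub>K\<^sup>2\<close>
  (\<open>second_moment_residue_dev\<close>): along \<open>K = n\<^sup>2\<close> the averages have summable second moments, and
  between consecutive squares they hardly change (\<open>AE_average_tendsto_0\<close>).

  The second moment is a sum of correlations of \<open>e(y^j)\<close> and \<open>e(y^k)\<close> with \<open>j < k\<close>, and of diagonal terms.
  The function \<open>e\<close> is periodic with mean zero, so it has a bounded primitive, and the integral of \<open>e(y^k)\<close>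
  over \<open>[c, d]\<close> is in absolute value at most \<open>2 / (k c^(k-1))\<close> (\<open>integral_residue_dev_power_bound\<close>).
  The factor \<open>e(y^j)\<close> is constant on each interval where \<open>m \<le> y^j < m + 1\<close>. Using the previous bound on each of these intervals and
  summing over \<open>m \<le> b^j\<close>, the correlation is at most a constant times \<open>a^(-(k-1-j))\<close>
  (\<open>integral_residue_dev_correlation\<close>). This is summable over the gap \<open>k - j\<close>, so the total is \<open>O(K)\<close>.\<close>

section \<open>The deviation of a residue class indicator from its mean\<close>

text \<open>The projection of the real line onto \<open>[0, 1]\<close>.\<close>
definition clamp01 :: "real \<Rightarrow> real" where
  "clamp01 x = max 0 (min 1 x)"

text \<open>The indicator of \<open>\<lfloor>x\<rfloor> \<equiv> r (mod q)\<close> minus its mean value \<open>1/q\<close>: a \<open>q\<close>-periodic step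
  function of mean zero.\<close>
definition residue_dev :: "nat \<Rightarrow> nat \<Rightarrow> real \<Rightarrow> real" where
  "residue_dev q r x = of_bool [\<lfloor>x\<rfloor> = int r] (mod int q) - 1 / real q"

text \<open>A primitive of \<^term>\<open>residue_dev q r\<close> on \<open>[0, qN)\<close>. The integral of the indicator grows linearly
  from 0 to 1 across each unit interval \<open>[r + qm, r + qm + 1]\<close>, so it is written as a sum of shifted
  clamps. Cutting the sum off at \<open>N\<close> keeps it finite; beyond \<open>qN\<close> it is not a primitive any more.\<close>
definition residue_dev_prim :: "nat \<Rightarrow> nat \<Rightarrow> nat \<Rightarrow> real \<Rightarrow> real" where
  "residue_dev_prim q r N x = (\<Sum>m<N. clamp01 (x - real (r + q * m))) - x / real q"

lemma abs_residue_dev_le_1: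
  assumes "q \<ge> 1" shows "\<bar>residue_dev q r x\<bar> \<le> 1"
proof -
  have "0 < 1 / real q" "1 / real q \<le> 1" using assms by auto
  then show ?thesis unfolding residue_dev_def of_bool_def by (auto simp del: of_nat_le_1_iff)
qed

lemma residue_dev_measurable [measurable]: "residue_dev q r \<in> borel_measurable borel"
proof -
  have "(\<lambda>n. of_bool [n = int r] (mod int q) - 1 / real q :: real) \<in> borel_measurable (count_space UNIV)"
    by simp
  from measurable_compose[OF measurable_real_floor this] show ?thesis
    unfolding residue_dev_def[abs_def] .
qed

lemma clamp01_has_derivative:
  assumes "x \<noteq> 0" "x \<noteq> 1"
  shows "(clamp01 has_field_derivative of_bool (0 < x \<and> x < 1)) (at x)"
proof -
  consider "x < 0" | "0 < x" "x < 1" | "x > 1" using assms by linarith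
  then show ?thesis
  proof cases
    case 1
    have "((\<lambda>_. 0) has_field_derivative 0) (at x)" by simp
    then have "(clamp01 has_field_derivative 0) (at x)"
      by (rule has_field_derivative_transform_within_open[where S = "{..<0}"])
         (use 1 in \<open>auto simp: clamp01_def\<close>)
    with 1 show ?thesis by simp
  next
    case 2
    have "((\<lambda>x. x) has_field_derivative 1) (at x)" by simp
    then have "(clamp01 has_field_derivative 1) (at x)"
      by (rule has_field_derivative_transform_within_open[where S = "{0<..<1}"])
         (use 2 in \<open>auto simp: clamp01_def\<close>)
    with 2 show ?thesis by simp
  next
    case 3
    have "((\<lambda>_. 1) has_field_derivative 0) (at x)" by simp
    then have "(clamp01 has_field_derivative 0) (at x)"
      by (rule has_field_derivative_transform_within_open[where S = "{1<..}"])
         (use 3 in \<open>auto simp: clamp01_def\<close>)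
    with 3 show ?thesis by simp
  qed
qed

lemma continuous_on_residue_dev_prim: "continuous_on A (residue_dev_prim q r N)"
  unfolding residue_dev_prim_def[abs_def] clamp01_def divide_inverse by (intro continuous_intros)

lemma residue_dev_prim_has_derivative:
  assumes q: "q \<ge> 1" "r < q" and x: "0 \<le> x" "x < real (q * N)" "x \<notin> \<int>"
  shows "(residue_dev_prim q r N has_field_derivative residue_dev q r x) (at x)"
proof -
  have "((\<lambda>x. clamp01 (x - real (r + q * m))) has_field_derivative
          of_bool (\<lfloor>x\<rfloor> = int (r + q * m))) (at x)" for m
  proof -
    let ?y = "x - real (r + q * m)"
    have ne: "?y \<noteq> 0" "?y \<noteq> 1"
      using x(3) by (metis Ints_of_nat diff_eq_eq Ints_add Ints_1 Ints_0)+
    have "of_bool (0 < ?y \<and> ?y < 1) = (of_bool (\<lfloor>x\<rfloor> = int (r + q * m)) :: real)"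
      using ne by (intro arg_cong[where f = of_bool]) (auto simp: floor_eq_iff)
    moreover have "((\<lambda>x. clamp01 (x - real (r + q * m))) has_field_derivative
          of_bool (0 < ?y \<and> ?y < 1) * 1) (at x)"
      by (rule DERIV_chain2[where f = clamp01 and g = "\<lambda>x. x - real (r + q * m)",
            OF clamp01_has_derivative[OF ne]])
         (auto intro!: derivative_eq_intros)
    ultimately show ?thesis by simp
  qed
  then have "(residue_dev_prim q r N has_field_derivative
      (\<Sum>m<N. of_bool (\<lfloor>x\<rfloor> = int (r + q * m))) - 1 / real q) (at x)"
    unfolding residue_dev_prim_def[abs_def]
    by (intro DERIV_diff DERIV_sum) (use q in \<open>auto intro!: derivative_eq_intros\<close>)
  moreover have "(\<Sum>m<N. of_bool (\<lfloor>x\<rfloor> = int (r + q * m))) =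
                 (of_bool [\<lfloor>x\<rfloor> = int r] (mod int q) :: real)"
  proof (cases "[\<lfloor>x\<rfloor> = int r] (mod int q)")
    case True
    define n where "n = nat \<lfloor>x\<rfloor>"
    have n: "\<lfloor>x\<rfloor> = int n" using x by (simp add: n_def)
    have "n mod q = r" using True q unfolding n cong_def by (simp flip: of_nat_mod)
    then have nd: "n = r + q * (n div q)" by (metis mult_div_mod_eq add.commute)
    have "real n \<le> x" using n x by (simp add: n_def)
    then have "n < q * N" using x(2) by linarith
    then have lt: "n div q < N" using q by (simp add: div_less_iff_less_mult mult.commute)
    have "(\<lfloor>x\<rfloor> = int (r + q * m)) \<longleftrightarrow> m = n div q" for m
    proof -
      have "r + q * (n div q) = r + q * m \<longleftrightarrow> m = n div q" using q by auto
      then show ?thesis using nd unfolding n of_nat_eq_iff by simp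
    qed
    then have "(\<Sum>m<N. of_bool (\<lfloor>x\<rfloor> = int (r + q * m))) = (\<Sum>m<N. if m = n div q then 1 else (0::real))"
      by (intro sum.cong) auto
    with lt True show ?thesis by simp
  next
    case False
    then have "\<lfloor>x\<rfloor> \<noteq> int (r + q * m)" for m
      by (auto simp: cong_def)
    with False show ?thesis by simp
  qed
  ultimately show ?thesis by (simp add: residue_dev_def)
qed

text \<open>At \<open>x\<close> in \<open>[qn, qn + q)\<close> the clamps with \<open>m < n\<close> equal 1 and those with \<open>m > n\<close> vanish, so their
  sum, like \<open>x/q\<close>, lies in \<open>[n, n + 1]\<close>. The bound does not depend on \<open>N\<close>.\<close>
lemma abs_residue_dev_prim_le_1:
  assumes q: "q \<ge> 1" "r < q" and x: "0 \<le> x" "x < real (q * N)"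
  shows "\<bar>residue_dev_prim q r N x\<bar> \<le> 1"
proof -
  define n where "n = nat \<lfloor>x / real q\<rfloor>"
  have "real n \<le> x / real q" "x / real q < real n + 1"
    using x unfolding n_def by (auto simp: le_floor_iff; linarith)+
  then have n: "real n \<le> x / real q" "x / real q < real n + 1" "real q * real n \<le> x" "x < real q * real n + real q"
    using q by (auto simp: field_simps)
  have "real q * real n < real q * real N" using n(3) x by simp
  then have nN: "n < N" using q by simp
  have c01: "0 \<le> clamp01 y" "clamp01 y \<le> 1" for y by (auto simp: clamp01_def)
  have lo: "(of_bool (m < n) :: real) \<le> clamp01 (x - real (r + q * m))" for m
  proof (cases "m < n")
    case True
    then have "q * Suc m \<le> q * n" by (intro mult_left_mono) auto
    then have "real q + real q * real m \<le> real q * real n"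
      by (metis mult_Suc_right of_nat_add of_nat_le_iff of_nat_mult)
    moreover have "real r + 1 \<le> real q" using q by linarith
    ultimately show ?thesis using n True by (simp add: clamp01_def)
  qed (simp add: c01)
  have hi: "clamp01 (x - real (r + q * m)) \<le> (of_bool (m \<le> n) :: real)" for m
  proof (cases "m \<le> n")
    case False
    then have "q * Suc n \<le> q * m" by (intro mult_left_mono) auto
    then have "real q + real q * real n \<le> real q * real m"
      by (metis mult_Suc_right of_nat_add of_nat_le_iff of_nat_mult)
    then show ?thesis using n False by (simp add: clamp01_def)
  qed (simp add: c01)
  have "real n = (\<Sum>m<N. of_bool (m < n))"
  proof -
    have "{..<N} \<inter> {m. m < n} = {..<n}" using nN by auto
    then show ?thesis by (simp add: of_bool_def sum.If_cases)
  qed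
  also have "\<dots> \<le> (\<Sum>m<N. clamp01 (x - real (r + q * m)))" by (intro sum_mono lo)
  finally have 1: "real n \<le> (\<Sum>m<N. clamp01 (x - real (r + q * m)))" .
  have "(\<Sum>m<N. clamp01 (x - real (r + q * m))) \<le> (\<Sum>m<N. of_bool (m \<le> n))" by (intro sum_mono hi)
  also have "\<dots> = real n + 1"
  proof -
    have "{..<N} \<inter> {m. m \<le> n} = {..n}" using nN by auto
    then show ?thesis by (simp add: of_bool_def sum.If_cases)
  qed
  finally show ?thesis using 1 n unfolding residue_dev_prim_def by linarith
qed

section \<open>Oscillation along powers\<close>

text \<open>Substituting \<open>u = y^(n+1)\<close> turns the integral into that of \<open>f u\<close> against a decreasing weight, and a
  bounded primitive of \<open>f\<close> gives cancellation. The proof integrates by parts without substituting: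
  \<open>G y = F (y^(n+1)) / ((n+1) y^n)\<close> has derivative \<open>f (y^(n+1)) - H y\<close> off a finite set, and \<open>H\<close> is
  dominated by the derivative of \<open>P y = - M / ((n+1) y^n)\<close>.\<close>
lemma integral_compose_power_bound:
  fixes f F :: "real \<Rightarrow> real"
  assumes cd: "0 < c" "c \<le> d" and S: "finite S"
    and cont: "continuous_on {c ^ Suc n..d ^ Suc n} F"
    and deriv: "\<And>x. x \<in> {c ^ Suc n..d ^ Suc n} - S \<Longrightarrow> (F has_field_derivative f x) (at x)"
    and bound: "\<And>x. x \<in> {c ^ Suc n..d ^ Suc n} \<Longrightarrow> \<bar>F x\<bar> \<le> M"
  shows "\<bar>integral {c..d} (\<lambda>y. f (y ^ Suc n))\<bar> \<le> 2 * M / (real (Suc n) * c ^ n)"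
proof -
  let ?N = "real (Suc n)"
  define G where "G y = F (y ^ Suc n) / (?N * y ^ n)" for y
  define H where "H y = F (y ^ Suc n) * real n / (?N * y ^ Suc n)" for y
  define P where "P y = - M / (?N * y ^ n)" for y
  have range: "y ^ Suc n \<in> {c ^ Suc n..d ^ Suc n}" if "y \<in> {c..d}" for y
    using that cd by (simp del: power_Suc add: power_mono)
  have cF: "continuous_on {c..d} (\<lambda>y. F (y ^ Suc n))"
    by (rule continuous_on_compose2[OF cont]) (use range in \<open>auto intro!: continuous_intros simp del: power_Suc\<close>)
  have cG: "continuous_on {c..d} G" and cH: "continuous_on {c..d} H"
    unfolding G_def H_def using cd by (auto intro!: continuous_intros cF simp del: power_Suc)
  define T where "T = {y \<in> {c..d}. y ^ Suc n \<in> S}"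
  have "inj_on (\<lambda>y. y ^ Suc n) T"
    using cd by (intro inj_onI) (simp add: T_def del: power_Suc, smt (verit) power_eq_imp_eq_base zero_less_Suc)
  moreover have "finite ((\<lambda>y. y ^ Suc n) ` T)" by (rule finite_subset[OF _ S]) (auto simp: T_def)
  ultimately have T: "finite T" using finite_image_iff by blast
  have dG: "(G has_vector_derivative (f (y ^ Suc n) - H y)) (at y)" if "y \<in> {c..d} - T" for y
  proof -
    have y: "y \<in> {c..d}" "y > 0" "y ^ Suc n \<notin> S" using that cd by (auto simp: T_def)
    have "((\<lambda>y. F (y ^ Suc n)) has_field_derivative f (y ^ Suc n) * (?N * y ^ n)) (at y)"
      by (rule DERIV_chain2[OF deriv]) (use range[OF y(1)] y in \<open>auto intro!: derivative_eq_intros simp del: power_Suc\<close>)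
    moreover have "((\<lambda>y. ?N * y ^ n) has_field_derivative ?N * (real n * y ^ (n - 1))) (at y)"
      by (auto intro!: derivative_eq_intros)
    ultimately have "(G has_field_derivative (f (y ^ Suc n) * (?N * y ^ n) * (?N * y ^ n) -
        F (y ^ Suc n) * (?N * (real n * y ^ (n - 1)))) / ((?N * y ^ n) * (?N * y ^ n))) (at y)"
      unfolding G_def[abs_def] by (rule DERIV_divide) (use y in simp)
    moreover have "(f (y ^ Suc n) * (?N * y ^ n) * (?N * y ^ n) -
        F (y ^ Suc n) * (?N * (real n * y ^ (n - 1)))) / ((?N * y ^ n) * (?N * y ^ n)) = f (y ^ Suc n) - H y"
      using y unfolding H_def by (cases n) (auto simp: divide_simps, (simp add: algebra_simps)?)
    ultimately show ?thesis by (simp add: has_real_derivative_iff_has_vector_derivative)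
  qed
  have iG: "((\<lambda>y. f (y ^ Suc n) - H y) has_integral (G d - G c)) {c..d}"
    by (rule fundamental_theorem_of_calculus_strong[OF T cd(2) dG cG])
  have iH: "H integrable_on {c..d}" by (rule integrable_continuous_real[OF cH])
  have "((\<lambda>y. (f (y ^ Suc n) - H y) + H y) has_integral (G d - G c + integral {c..d} H)) {c..d}"
    by (rule has_integral_add[OF iG integrable_integral[OF iH]])
  then have eq: "integral {c..d} (\<lambda>y. f (y ^ Suc n)) = G d - G c + integral {c..d} H"
    by (simp add: integral_unique)
  have iP: "((\<lambda>y. M * real n / (?N * y ^ Suc n)) has_integral (P d - P c)) {c..d}"
  proof (rule fundamental_theorem_of_calculus[OF cd(2)])
    fix y assume "y \<in> {c..d}"
    then have y: "y > 0" using cd by auto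
    have "((\<lambda>y. ?N * y ^ n) has_field_derivative ?N * (real n * y ^ (n - 1))) (at y)"
      by (auto intro!: derivative_eq_intros)
    with DERIV_const[of "- M" "at y"]
    have "(P has_field_derivative (0 * (?N * y ^ n) - (- M) * (?N * (real n * y ^ (n - 1)))) /
        ((?N * y ^ n) * (?N * y ^ n))) (at y)"
      unfolding P_def[abs_def] by (rule DERIV_divide) (use y in simp)
    moreover have "(0 * (?N * y ^ n) - (- M) * (?N * (real n * y ^ (n - 1)))) /
        ((?N * y ^ n) * (?N * y ^ n)) = M * real n / (?N * y ^ Suc n)"
      using y by (cases n) (auto simp: divide_simps)
    ultimately have "(P has_field_derivative M * real n / (?N * y ^ Suc n)) (at y)" by simp
    then show "(P has_vector_derivative M * real n / (?N * y ^ Suc n)) (at y within {c..d})"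
      by (simp add: has_real_derivative_iff_has_vector_derivative has_vector_derivative_at_within)
  qed
  have "norm (integral {c..d} H) \<le> integral {c..d} (\<lambda>y. M * real n / (?N * y ^ Suc n))"
  proof (rule integral_norm_bound_integral[OF iH])
    show "(\<lambda>y. M * real n / (?N * y ^ Suc n)) integrable_on {c..d}" using iP by blast
    fix y assume y: "y \<in> {c..d}"
    have "norm (H y) = \<bar>F (y ^ Suc n)\<bar> * real n / (?N * y ^ Suc n)"
      unfolding H_def using y cd by (simp add: abs_mult)
    also have "\<dots> \<le> M * real n / (?N * y ^ Suc n)"
      using y cd bound[OF range[OF y]] by (intro divide_right_mono mult_right_mono) auto
    finally show "norm (H y) \<le> M * real n / (?N * y ^ Suc n)" .
  qed
  also have "\<dots> = P d - P c" using iP by (rule integral_unique)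
  finally have bH: "\<bar>integral {c..d} H\<bar> \<le> M / (?N * c ^ n) - M / (?N * d ^ n)" by (simp add: P_def)
  have bG: "\<bar>G y\<bar> \<le> M / (?N * y ^ n)" if "y \<in> {c..d}" for y
  proof -
    have "\<bar>G y\<bar> = \<bar>F (y ^ Suc n)\<bar> / (?N * y ^ n)" unfolding G_def using that cd by (simp add: abs_mult)
    also have "\<dots> \<le> M / (?N * y ^ n)" using that cd bound[OF range[OF that]] by (intro divide_right_mono) auto
    finally show ?thesis .
  qed
  have "c \<in> {c..d}" "d \<in> {c..d}" using cd by auto
  then have "\<bar>G d - G c + integral {c..d} H\<bar> \<le> M / (?N * c ^ n) + M / (?N * c ^ n)"
    using bH bG[of c] bG[of d] by linarith
  also have "\<dots> = 2 * M / (?N * c ^ n)" by simp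
  finally show ?thesis unfolding eq .
qed

lemma integrable_lebesgue_on_Icc_bounded:
  fixes f :: "real \<Rightarrow> real"
  assumes "f \<in> borel_measurable borel" "\<And>x. \<bar>f x\<bar> \<le> B"
  shows "integrable (lebesgue_on {a..b}) f"
proof -
  interpret finite_measure "lebesgue_on {a..b}" by (rule finite_measure_lebesgue_on) simp
  have "f \<in> borel_measurable (lebesgue_on {a..b})"
    using assms(1) by (intro measurable_restrict_space1 measurable_completion) simp
  then show ?thesis by (intro integrable_const_bound[of _ B]) (use assms(2) in auto)
qed

lemma integral_residue_dev_power_bound:
  assumes q: "q \<ge> 1" "r < q" and cd: "0 < c" "c \<le> d"
  shows "\<bar>integral {c..d} (\<lambda>y. residue_dev q r (y ^ Suc n))\<bar> \<le> 2 / (real (Suc n) * c ^ n)"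
proof -
  obtain N :: nat where N: "d ^ Suc n < real N" using reals_Archimedean2 by blast
  have "1 * N \<le> q * N" using q by (intro mult_right_mono) auto
  then have "real N \<le> real (q * N)" unfolding of_nat_le_iff by simp
  with N have dN: "d ^ Suc n < real (q * N)" by linarith
  have pos: "0 < c ^ Suc n" using cd by simp
  have "\<bar>integral {c..d} (\<lambda>y. residue_dev q r (y ^ Suc n))\<bar> \<le> 2 * 1 / (real (Suc n) * c ^ n)"
  proof (rule integral_compose_power_bound[OF cd, where S = "real ` {..N}" and F = "residue_dev_prim q r N"])
    fix x assume x: "x \<in> {c ^ Suc n..d ^ Suc n} - real ` {..N}"
    have "x \<notin> \<int>"
    proof
      assume "x \<in> \<int>"
      then obtain i where i: "x = of_int i" by (elim Ints_cases)
      have "0 \<le> i" using x pos by (simp add: i del: power_Suc)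
      then have "x = real (nat i)" by (simp add: i)
      moreover have "nat i \<le> N" using x N by (simp add: i \<open>0 \<le> i\<close> nat_le_iff del: power_Suc)
      ultimately show False using x by blast
    qed
    then show "(residue_dev_prim q r N has_field_derivative residue_dev q r x) (at x)"
      using x pos dN by (intro residue_dev_prim_has_derivative[OF q]) auto
  next
    fix x assume "x \<in> {c ^ Suc n..d ^ Suc n}"
    then show "\<bar>residue_dev_prim q r N x\<bar> \<le> 1"
      using pos dN by (intro abs_residue_dev_prim_le_1[OF q]) auto
  qed (auto intro: continuous_on_residue_dev_prim)
  then show ?thesis by simp
qed

text \<open>The first factor is constant on the interior of an interval on which \<open>\<lfloor>y^j\<rfloor> = m\<close>.\<close>
lemma integral_residue_dev_piece:
  assumes q: "q \<ge> 1" "r < q" and st: "0 < s" "s \<le> t" and m: "real m \<le> s ^ j" "t ^ j \<le> real m + 1"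
    and j: "j \<ge> 1"
  shows "\<bar>integral {s..t} (\<lambda>y. residue_dev q r (y ^ j) * residue_dev q r (y ^ Suc n))\<bar> \<le>
           2 / (real (Suc n) * s ^ n)"
proof -
  have "integral {s..t} (\<lambda>y. residue_dev q r (y ^ j) * residue_dev q r (y ^ Suc n)) =
        integral {s..t} (\<lambda>y. residue_dev q r (real m) * residue_dev q r (y ^ Suc n))"
  proof (rule integral_spike[of "{s, t}"])
    fix y assume "y \<in> {s..t} - {s, t}"
    then have y: "s < y" "y < t" by auto
    have "s ^ j < y ^ j" "y ^ j < t ^ j" using y st j by (auto intro!: power_strict_mono)
    then have "\<lfloor>y ^ j\<rfloor> = int m" using m by (simp add: floor_eq_iff)
    then have "residue_dev q r (y ^ j) = residue_dev q r (real m)" by (simp add: residue_dev_def)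
    then show "residue_dev q r (real m) * residue_dev q r (y ^ Suc n) =
               residue_dev q r (y ^ j) * residue_dev q r (y ^ Suc n)" by simp
  qed simp
  also have "\<dots> = residue_dev q r (real m) * integral {s..t} (\<lambda>y. residue_dev q r (y ^ Suc n))" by simp
  also have "\<bar>\<dots>\<bar> \<le> 1 * (2 / (real (Suc n) * s ^ n))"
    unfolding abs_mult
    by (intro mult_mono abs_residue_dev_le_1 integral_residue_dev_power_bound) (use q st in auto)
  finally show ?thesis by simp
qed

text \<open>Cutting \<open>[a, t]\<close> at the points \<open>m^(1/j)\<close>, the piece starting at \<open>s \<ge> m^(1/j)\<close> contributes at most
  \<open>2 / ((n+1) s^n)\<close>, and \<open>s^n = s^j s^(n-j) \<ge> m a^(n-j)\<close>; summing over \<open>m\<close> gives a harmonic number.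
  The induction peels off the last piece.\<close>
lemma integral_residue_dev_correlation_harm:
  assumes q: "q \<ge> 1" "r < q" and a: "1 < a" and j: "1 \<le> j" "j \<le> n"
  shows "a \<le> t \<Longrightarrow> t ^ j \<le> real N + 1 \<Longrightarrow>
    \<bar>integral {a..t} (\<lambda>y. residue_dev q r (y ^ j) * residue_dev q r (y ^ Suc n))\<bar> \<le>
      2 / (real (Suc n) * a ^ (n - j)) * harm N"
proof (induction N arbitrary: t)
  case 0
  have "1 < t ^ j" using 0 a j by (intro one_less_power) auto
  with 0 show ?case by simp
next
  case (Suc N)
  let ?h = "\<lambda>y. residue_dev q r (y ^ j) * residue_dev q r (y ^ Suc n)"
  let ?D = "2 / (real (Suc n) * a ^ (n - j))"
  have D: "?D \<ge> 0" using a by simp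
  show ?case
  proof (cases "t ^ j \<le> real N + 1")
    case True
    from Suc.IH[OF Suc.prems(1) this] have "\<bar>integral {a..t} ?h\<bar> \<le> ?D * harm N" .
    also have "\<dots> \<le> ?D * harm (Suc N)" by (intro mult_left_mono D harm_mono) simp
    finally show ?thesis .
  next
    case False
    \<comment> \<open>The last piece starts at the cut point, or at \<open>a\<close> if the cut point lies to the left of \<open>a\<close>.\<close>
    define s where "s = max a (root j (real (Suc N)))"
    have rj: "root j (real (Suc N)) ^ j = real (Suc N)" using j by (simp add: real_root_pow_pos2)
    have sa: "a \<le> s" by (simp add: s_def)
    have "root j (real (Suc N)) \<le> root j (t ^ j)" using False j by simp
    also have "\<dots> = t" using Suc.prems a j by (simp add: real_root_power_cancel)
    finally have st: "s \<le> t" using Suc.prems by (simp add: s_def)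
    have "root j (real (Suc N)) ^ j \<le> s ^ j" using j by (intro power_mono) (auto simp: s_def)
    then have sj: "real (Suc N) \<le> s ^ j" using rj by simp
    have "\<bar>integral {a..s} ?h\<bar> \<le> ?D * harm N"
    proof (cases "s = a")
      case True
      then show ?thesis using D by (simp add: harm_nonneg)
    next
      case False
      then have "s = root j (real (Suc N))" by (auto simp: s_def max_def split: if_splits)
      then have "s ^ j \<le> real N + 1" using rj by simp
      then show ?thesis by (rule Suc.IH[OF sa])
    qed
    moreover have "\<bar>integral {s..t} ?h\<bar> \<le> ?D / real (Suc N)"
    proof -
      have "\<bar>integral {s..t} ?h\<bar> \<le> 2 / (real (Suc n) * s ^ n)"
        using Suc.prems sa st sj a j by (intro integral_residue_dev_piece[where m = "Suc N"] q) auto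
      also have "real (Suc N) * a ^ (n - j) \<le> s ^ j * s ^ (n - j)"
        using a sa by (intro mult_mono sj power_mono) auto
      then have "real (Suc n) * (real (Suc N) * a ^ (n - j)) \<le> real (Suc n) * s ^ n"
        using j by (intro mult_left_mono) (auto simp flip: power_add)
      then have "2 / (real (Suc n) * s ^ n) \<le> 2 / (real (Suc n) * (real (Suc N) * a ^ (n - j)))"
        using a by (intro divide_left_mono mult_pos_pos) (auto simp: sa less_le_trans[OF _ sa])
      also have "\<dots> = ?D / real (Suc N)" by simp
      finally show ?thesis .
    qed
    moreover have "integral {a..s} ?h + integral {s..t} ?h = integral {a..t} ?h"
    proof (rule Henstock_Kurzweil_Integration.integral_combine[OF sa st])
      have "\<bar>?h y\<bar> \<le> 1 * 1" for y
        unfolding abs_mult using q by (intro mult_mono abs_residue_dev_le_1) auto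
      then have "integrable (lebesgue_on {a..t}) ?h"
        by (intro integrable_lebesgue_on_Icc_bounded) auto
      then show "?h integrable_on {a..t}" by (rule integrable_on_lebesgue_on) simp
    qed
    ultimately have "\<bar>integral {a..t} ?h\<bar> \<le> ?D * harm N + ?D / real (Suc N)" by linarith
    also have "\<dots> = ?D * harm (Suc N)" by (simp only: harm_Suc distrib_left divide_inverse)
    finally show ?thesis .
  qed
qed

lemma harm_le_ln: "n \<ge> 1 \<Longrightarrow> harm n \<le> 1 + ln (real n)"
  using euler_mascheroni_sequence_decreasing[of 1 n] by (simp add: harm_expand)

text \<open>Since \<open>harm N\<close> is at most \<open>1 + j ln b\<close> for \<open>N \<le> b^j\<close>, the factor \<open>1/(n+1)\<close> with \<open>n + 1 > j\<close> absorbs the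
  growth in \<open>j\<close>. What remains decays geometrically in the gap between the two exponents.\<close>
lemma integral_residue_dev_correlation:
  assumes q: "q \<ge> 1" "r < q" and a: "1 < a" "a \<le> b" and j: "1 \<le> j" "j \<le> n"
  shows "\<bar>integral {a..b} (\<lambda>y. residue_dev q r (y ^ j) * residue_dev q r (y ^ Suc n))\<bar> \<le>
           2 * (1 + ln b) * (1 / a) ^ (n - j)"
proof -
  define N where "N = nat \<lfloor>b ^ j\<rfloor>"
  have b1: "1 \<le> b ^ j" using a by (intro one_le_power) auto
  have N: "real N \<le> b ^ j" "b ^ j \<le> real N + 1" "N \<ge> 1"
    using b1 unfolding N_def by (auto simp: le_nat_iff le_floor_iff)
  have "harm N \<le> 1 + ln (real N)" by (rule harm_le_ln[OF N(3)])
  also have "\<dots> \<le> 1 + ln (b ^ j)" using N by simp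
  also have "\<dots> = 1 + real j * ln b" using a by (simp add: ln_realpow)
  also have "\<dots> \<le> real (Suc n) * (1 + ln b)"
  proof -
    have "real j * ln b \<le> real (Suc n) * ln b" using j a by (intro mult_right_mono) auto
    moreover have "1 \<le> real (Suc n)" by simp
    ultimately show ?thesis by (simp only: distrib_left mult_1_right)
  qed
  finally have h: "harm N \<le> real (Suc n) * (1 + ln b)" .
  have "\<bar>integral {a..b} (\<lambda>y. residue_dev q r (y ^ j) * residue_dev q r (y ^ Suc n))\<bar> \<le>
      2 / (real (Suc n) * a ^ (n - j)) * harm N"
    by (rule integral_residue_dev_correlation_harm[OF q a(1) j a(2) N(2)])
  also have "\<dots> \<le> 2 / (real (Suc n) * a ^ (n - j)) * (real (Suc n) * (1 + ln b))"
    using a by (intro mult_left_mono h) auto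
  also have "\<dots> = 2 * (1 + ln b) * (1 / a) ^ (n - j)"
    by (simp add: power_divide del: of_nat_Suc)
  finally show ?thesis .
qed

section \<open>Second moments\<close>

lemma sum_geometric_le:
  fixes a :: real
  assumes "1 < a"
  shows "(\<Sum>j=1..n. (1 / a) ^ (n - j)) \<le> a / (a - 1)"
proof -
  have "(\<Sum>j=1..n. (1 / a) ^ (n - j)) = (\<Sum>i<n. (1 / a) ^ i)"
    by (rule sum.reindex_bij_witness[of _ "\<lambda>i. n - i" "\<lambda>j. n - j"]) auto
  also have "\<dots> \<le> (\<Sum>i. (1 / a) ^ i)"
    using assms by (intro sum_le_suminf summable_geometric) auto
  also have "\<dots> = a / (a - 1)"
    using assms by (subst suminf_geometric) (auto simp: field_simps)
  finally show ?thesis .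
qed

text \<open>Adding the term with exponent \<open>n + 1\<close> changes the second moment by twice the sum of its correlations
  with the earlier terms, which is bounded by a geometric series, and by a diagonal term of at most
  \<open>b - a\<close>.\<close>
lemma second_moment_residue_dev:
  assumes q: "q \<ge> 1" "r < q" and a: "1 < a" "a \<le> b"
  shows "integral {a..b} (\<lambda>y. (\<Sum>k=1..K. residue_dev q r (y ^ k))\<^sup>2) \<le>
           (4 * (1 + ln b) * (a / (a - 1)) + (b - a)) * real K"
proof (induction K)
  case (Suc n)
  define e where "e k y = residue_dev q r (y ^ k)" for k and y :: real
  define S where "S y = (\<Sum>k=1..n. e k y)" for y
  have [measurable]: "e k \<in> borel_measurable borel" for k unfolding e_def[abs_def] by measurable
  have [measurable]: "S \<in> borel_measurable borel" unfolding S_def[abs_def] by measurable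
  have e1: "\<bar>e k y\<bar> \<le> 1" for k y unfolding e_def using q by (intro abs_residue_dev_le_1)
  have int: "f integrable_on {a..b}" if "f \<in> borel_measurable borel" "\<And>x. \<bar>f x\<bar> \<le> B"
    for f :: "real \<Rightarrow> real" and B
    by (rule integrable_on_lebesgue_on[OF integrable_lebesgue_on_Icc_bounded]) (use that in auto)
  have S1: "\<bar>S y\<bar> \<le> real n" for y
  proof -
    have "\<bar>S y\<bar> \<le> (\<Sum>k=1..n. \<bar>e k y\<bar>)" unfolding S_def by (rule sum_abs)
    also have "\<dots> \<le> (\<Sum>k=1..n. 1)" by (intro sum_mono e1)
    finally show ?thesis by simp
  qed
  have ee: "\<bar>e i y * e k y\<bar> \<le> 1 * 1" for i k y unfolding abs_mult by (intro mult_mono e1) auto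
  have iee: "(\<lambda>y. e i y * e k y) integrable_on {a..b}" for i k
    by (rule int[OF _ ee]) measurable
  have SS: "\<bar>S y * S y\<bar> \<le> real n * real n" for y unfolding abs_mult by (intro mult_mono S1) auto
  have iSS: "(\<lambda>y. S y * S y) integrable_on {a..b}"
    by (rule int[OF _ SS]) measurable
  have Se: "S y * e (Suc n) y = (\<Sum>j=1..n. e j y * e (Suc n) y)" for y by (simp add: S_def sum_distrib_right)
  have iSe: "(\<lambda>y. S y * e (Suc n) y) integrable_on {a..b}"
    unfolding Se by (intro integrable_sum iee) auto
  have "integral {a..b} (\<lambda>y. S y * e (Suc n) y) = (\<Sum>j=1..n. integral {a..b} (\<lambda>y. e j y * e (Suc n) y))"
    unfolding Se by (intro integral_sum iee) auto
  also have "\<dots> \<le> (\<Sum>j=1..n. 2 * (1 + ln b) * (1 / a) ^ (n - j))"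
  proof (rule sum_mono)
    fix j assume "j \<in> {1..n}"
    then have "\<bar>integral {a..b} (\<lambda>y. e j y * e (Suc n) y)\<bar> \<le> 2 * (1 + ln b) * (1 / a) ^ (n - j)"
      unfolding e_def by (intro integral_residue_dev_correlation q a) auto
    then show "integral {a..b} (\<lambda>y. e j y * e (Suc n) y) \<le> 2 * (1 + ln b) * (1 / a) ^ (n - j)" by linarith
  qed
  also have "\<dots> = 2 * (1 + ln b) * (\<Sum>j=1..n. (1 / a) ^ (n - j))" by (simp only: sum_distrib_left)
  also have "\<dots> \<le> 2 * (1 + ln b) * (a / (a - 1))"
    using a by (intro mult_left_mono sum_geometric_le) auto
  finally have cross: "integral {a..b} (\<lambda>y. S y * e (Suc n) y) \<le> 2 * (1 + ln b) * (a / (a - 1))" .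
  have "integral {a..b} (\<lambda>y. e (Suc n) y * e (Suc n) y) \<le> integral {a..b} (\<lambda>y. 1)"
    using ee by (intro integral_le iee) (auto simp: abs_le_iff)
  then have diag: "integral {a..b} (\<lambda>y. e (Suc n) y * e (Suc n) y) \<le> b - a" using a by simp
  let ?C = "4 * (1 + ln b) * (a / (a - 1)) + (b - a)"
  have "integral {a..b} (\<lambda>y. (\<Sum>k=1..Suc n. residue_dev q r (y ^ k))\<^sup>2) =
        integral {a..b} (\<lambda>y. (S y * S y + 2 * (S y * e (Suc n) y)) + e (Suc n) y * e (Suc n) y)"
    by (intro arg_cong[where f = "integral {a..b}"] ext)
       (simp add: S_def e_def power2_eq_square algebra_simps)
  also have "\<dots> = integral {a..b} (\<lambda>y. S y * S y) + 2 * integral {a..b} (\<lambda>y. S y * e (Suc n) y)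
                 + integral {a..b} (\<lambda>y. e (Suc n) y * e (Suc n) y)"
    using iSS iSe iee by (simp add: integral_add integrable_add)
  finally have split: "integral {a..b} (\<lambda>y. (\<Sum>k=1..Suc n. residue_dev q r (y ^ k))\<^sup>2) = \<dots>" .
  have "integral {a..b} (\<lambda>y. S y * S y) \<le> ?C * real n"
    using Suc.IH by (simp add: S_def e_def power2_eq_square)
  moreover have "?C * real (Suc n) = ?C * real n + 2 * (2 * (1 + ln b) * (a / (a - 1))) + (b - a)"
    by (simp add: distrib_left)
  ultimately show ?case unfolding split using cross diag by linarith
qed simp

section \<open>From second moments to almost everywhere convergence\<close>

text \<open>Between \<open>n\<^sup>2\<close> and \<open>(n+1)\<^sup>2\<close> a sequence with increments at most 1 moves by at most \<open>2n\<close>, which is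
  negligible against \<open>n\<^sup>2\<close>.\<close>
lemma average_tendsto_0_from_squares:
  fixes s :: "nat \<Rightarrow> real"
  assumes step: "\<And>K. \<bar>s (Suc K) - s K\<bar> \<le> 1"
    and lim: "(\<lambda>n. s (n\<^sup>2) / real (n\<^sup>2)) \<longlonglongrightarrow> 0"
  shows "(\<lambda>K. s K / real K) \<longlonglongrightarrow> 0"
proof -
  have lip: "\<bar>s (m + d) - s m\<bar> \<le> real d" for m d
  proof (induction d)
    case (Suc d)
    then show ?case using step[of "m + d"] by simp
  qed simp
  have fs: "filterlim floor_sqrt sequentially sequentially"
    unfolding filterlim_at_top
  proof
    fix Z :: nat
    have "Z \<le> floor_sqrt K" if "Z\<^sup>2 \<le> K" for K
      using monoD[OF mono_floor_sqrt that] by simp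
    then show "\<forall>\<^sub>F K in sequentially. Z \<le> floor_sqrt K" by (rule eventually_sequentiallyI)
  qed
  let ?b = "\<lambda>n. \<bar>s (n\<^sup>2) / real (n\<^sup>2)\<bar> + 2 * inverse (real n)"
  have "?b \<longlonglongrightarrow> \<bar>0\<bar> + 2 * 0"
    by (intro tendsto_intros lim lim_inverse_n)
  then have "(\<lambda>K. ?b (floor_sqrt K)) \<longlonglongrightarrow> 0"
    using filterlim_compose[OF _ fs] by simp
  then show ?thesis
  proof (rule Lim_null_comparison[rotated], intro eventually_sequentiallyI[of 1])
    fix K :: nat assume "1 \<le> K"
    define n where "n = floor_sqrt K"
    define d where "d = K - n\<^sup>2"
    have le: "n\<^sup>2 \<le> K" unfolding n_def by simp
    have "K < (Suc n)\<^sup>2" unfolding n_def by (rule Suc_floor_sqrt_power2_gt)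
    then have d: "d \<le> 2 * n" "K = n\<^sup>2 + d" using le by (auto simp: d_def power2_eq_square)
    have "n > 0" using \<open>1 \<le> K\<close> unfolding n_def by simp
    then have n2: "real (n\<^sup>2) > 0" by simp
    have "\<bar>s K\<bar> \<le> \<bar>s (n\<^sup>2)\<bar> + real d" using lip[of "n\<^sup>2" d] unfolding d(2) by linarith
    also have "\<dots> \<le> \<bar>s (n\<^sup>2)\<bar> + 2 * real n" using d(1) by linarith
    finally have "\<bar>s K\<bar> / real K \<le> (\<bar>s (n\<^sup>2)\<bar> + 2 * real n) / real (n\<^sup>2)"
      using le n2 by (intro frac_le) auto
    also have "\<dots> = ?b n" using \<open>n > 0\<close> by (simp add: field_simps power2_eq_square)
    finally show "norm (s K / real K) \<le> ?b (floor_sqrt K)" by (simp add: n_def)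
  qed
qed

text \<open>A strong law of large numbers under a second moment bound that is linear in \<open>K\<close>: the squares of the
  averages at the times \<open>K = n\<^sup>2\<close> have integrals bounded by a multiple of \<open>1/n\<^sup>2\<close>, hence are almost
  everywhere summable.\<close>
lemma AE_average_tendsto_0:
  fixes X :: "nat \<Rightarrow> 'a \<Rightarrow> real"
  assumes meas [measurable]: "\<And>k. X k \<in> borel_measurable M"
    and bound: "\<And>k w. w \<in> space M \<Longrightarrow> \<bar>X k w\<bar> \<le> 1"
    and moment: "\<And>K. (\<integral>\<^sup>+w. ennreal ((\<Sum>k=1..K. X k w)\<^sup>2) \<partial>M) \<le> ennreal (C * real K)"
  shows "AE w in M. (\<lambda>K. (\<Sum>k=1..K. X k w) / real K) \<longlonglongrightarrow> 0"
proof -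
  define S where "S K w = (\<Sum>k=1..K. X k w)" for K w
  have [measurable]: "S K \<in> borel_measurable M" for K unfolding S_def[abs_def] by measurable
  define T where "T n w = (S (n\<^sup>2) w / real (n\<^sup>2))\<^sup>2" for n w
  have [measurable]: "T n \<in> borel_measurable M" for n unfolding T_def[abs_def] by measurable
  \<comment> \<open>The map \<open>ennreal\<close> is multiplicative on nonnegative reals only, and \<open>C\<close> may be negative.\<close>
  define B where "B = \<bar>C\<bar>"
  have "(\<integral>\<^sup>+w. ennreal (T n w) \<partial>M) \<le> ennreal (B * (1 / (real n)\<^sup>2))" for n
  proof (cases "n = 0")
    case False
    have "(\<integral>\<^sup>+w. ennreal (T n w) \<partial>M) = (\<integral>\<^sup>+w. ennreal (1 / (real (n\<^sup>2))\<^sup>2) * ennreal ((S (n\<^sup>2) w)\<^sup>2) \<partial>M)"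
      by (intro nn_integral_cong) (simp add: T_def power_divide flip: ennreal_mult)
    also have "\<dots> = ennreal (1 / (real (n\<^sup>2))\<^sup>2) * (\<integral>\<^sup>+w. ennreal ((S (n\<^sup>2) w)\<^sup>2) \<partial>M)"
      by (rule nn_integral_cmult) measurable
    also have "\<dots> \<le> ennreal (1 / (real (n\<^sup>2))\<^sup>2) * ennreal (B * real (n\<^sup>2))"
      unfolding S_def B_def
      by (intro mult_left_mono order_trans[OF moment] ennreal_leI mult_right_mono) auto
    also have "\<dots> = ennreal (B * (1 / (real n)\<^sup>2))"
      using False by (simp add: B_def power2_eq_square flip: ennreal_mult)
    finally show ?thesis .
  qed (simp add: T_def)
  then have "(\<Sum>n. \<integral>\<^sup>+w. ennreal (T n w) \<partial>M) \<le> (\<Sum>n. ennreal (B * (1 / (real n)\<^sup>2)))"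
    by (intro suminf_le) auto
  also have "\<dots> < \<infinity>"
  proof -
    have "summable (\<lambda>n. B * (1 / (real n)\<^sup>2))"
      using inverse_power_summable[of 2, where 'a = real]
      by (intro summable_mult) (simp add: inverse_eq_divide)
    then have "(\<Sum>n. ennreal (B * (1 / (real n)\<^sup>2))) = ennreal (\<Sum>n. B * (1 / (real n)\<^sup>2))"
      by (intro suminf_ennreal_eq summable_sums) (auto simp: B_def)
    then show ?thesis by simp
  qed
  finally have "(\<Sum>n. \<integral>\<^sup>+w. ennreal (T n w) \<partial>M) < \<infinity>" .
  then have "(\<integral>\<^sup>+w. (\<Sum>n. ennreal (T n w)) \<partial>M) \<noteq> \<infinity>"
    by (subst nn_integral_suminf) auto
  then have "AE w in M. (\<Sum>n. ennreal (T n w)) \<noteq> \<infinity>"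
    by (intro nn_integral_noteq_infinite) auto
  then show ?thesis
  proof (rule AE_mp[OF _ AE_I2], intro impI)
    fix w assume w: "w \<in> space M" and "(\<Sum>n. ennreal (T n w)) \<noteq> \<infinity>"
    then have "summable (\<lambda>n. T n w)"
      by (intro summable_suminf_not_top) (auto simp: T_def)
    then have "(\<lambda>n. sqrt (T n w)) \<longlonglongrightarrow> sqrt 0"
      by (intro tendsto_real_sqrt summable_LIMSEQ_zero)
    then have "(\<lambda>n. S (n\<^sup>2) w / real (n\<^sup>2)) \<longlonglongrightarrow> 0"
      unfolding T_def real_sqrt_abs real_sqrt_zero by (rule tendsto_rabs_zero_cancel)
    then have "(\<lambda>K. S K w / real K) \<longlonglongrightarrow> 0"
      by (intro average_tendsto_0_from_squares) (use bound[OF w] in \<open>auto simp: S_def\<close>)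
    then show "(\<lambda>K. (\<Sum>k=1..K. X k w) / real K) \<longlonglongrightarrow> 0" by (simp add: S_def)
  qed
qed

lemma AE_average_residue_dev:
  assumes q: "q \<ge> 1" "r < q" and a: "1 < a" "a \<le> b"
  shows "AE y in lebesgue_on {a..b}. (\<lambda>K. (\<Sum>k=1..K. residue_dev q r (y ^ k)) / real K) \<longlonglongrightarrow> 0"
proof (rule AE_average_tendsto_0)
  fix k
  show "(\<lambda>y. residue_dev q r (y ^ k)) \<in> borel_measurable (lebesgue_on {a..b})"
    by (intro measurable_restrict_space1 measurable_completion) simp
next
  fix K
  let ?f = "\<lambda>y. (\<Sum>k=1..K. residue_dev q r (y ^ k))\<^sup>2"
  have b: "\<bar>?f y\<bar> \<le> (real K)\<^sup>2" for y
  proof -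
    have "\<bar>\<Sum>k=1..K. residue_dev q r (y ^ k)\<bar> \<le> (\<Sum>k=1..K. \<bar>residue_dev q r (y ^ k)\<bar>)" by (rule sum_abs)
    also have "\<dots> \<le> (\<Sum>k=1..K. 1)" by (intro sum_mono abs_residue_dev_le_1 q)
    finally have "\<bar>\<Sum>k=1..K. residue_dev q r (y ^ k)\<bar> \<le> \<bar>real K\<bar>" by simp
    then have "(\<Sum>k=1..K. residue_dev q r (y ^ k))\<^sup>2 \<le> (real K)\<^sup>2" unfolding abs_le_square_iff .
    then show ?thesis by simp
  qed
  have i: "integrable (lebesgue_on {a..b}) ?f"
    by (rule integrable_lebesgue_on_Icc_bounded[OF _ b]) measurable
  have "(\<integral>\<^sup>+y. ennreal (?f y) \<partial>lebesgue_on {a..b}) = ennreal (integral\<^sup>L (lebesgue_on {a..b}) ?f)"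
    by (rule nn_integral_eq_integral[OF i]) simp
  also have "integral\<^sup>L (lebesgue_on {a..b}) ?f = integral {a..b} ?f"
    by (rule lebesgue_integral_eq_integral[OF i]) simp
  also have "ennreal \<dots> \<le> ennreal ((4 * (1 + ln b) * (a / (a - 1)) + (b - a)) * real K)"
    by (intro ennreal_leI second_moment_residue_dev q a)
  finally show "(\<integral>\<^sup>+y. ennreal (?f y) \<partial>lebesgue_on {a..b}) \<le> \<dots>" .
qed (use abs_residue_dev_le_1 q in auto)

lemma count_minus_expected_eq_sum_residue_dev:
  "real (card {k. 1 \<le> k \<and> k \<le> K \<and> [\<lfloor>y ^ k\<rfloor> = int r] (mod int q)}) - real K / real q =
     (\<Sum>k=1..K. residue_dev q r (y ^ k))"
proof -
  have "{k. 1 \<le> k \<and> k \<le> K \<and> [\<lfloor>y ^ k\<rfloor> = int r] (mod int q)} =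
        {1..K} \<inter> {k. [\<lfloor>y ^ k\<rfloor> = int r] (mod int q)}" by auto
  then show ?thesis by (simp add: residue_dev_def sum_subtractf of_bool_def sum.If_cases)
qed

theorem lemma3p5:
  shows "AE y :: real in lebesgue. y > 1 \<longrightarrow>
    (\<forall>q r :: nat. q \<ge> 1 \<longrightarrow> r < q \<longrightarrow>
      (\<lambda>K :: nat. real (card {k :: nat. 1 \<le> k \<and> k \<le> K \<and> [\<lfloor>y ^ k\<rfloor> = int r] (mod int q)})
          - real K / real q)
        \<in> o[at_top](\<lambda>K. real K))"
proof -
  \<comment> \<open>The countably many intervals \<open>[lo i, hi i]\<close> exhaust \<open>(1, \<infinity>)\<close>.\<close>
  define lo hi where "lo i = 1 + 1 / real (Suc i)" and "hi i = 1 + real (Suc i)" for i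
  have lh: "1 < lo i" "lo i \<le> hi i" for i
  proof -
    have "1 / real (Suc i) \<le> 1" "1 \<le> real (Suc i)" by auto
    then show "lo i \<le> hi i" unfolding lo_def hi_def by linarith
  qed (simp add: lo_def)
  have "AE y in lebesgue. y \<in> {lo i..hi i} \<longrightarrow> q \<ge> 1 \<longrightarrow> r < q \<longrightarrow>
          (\<lambda>K. (\<Sum>k=1..K. residue_dev q r (y ^ k)) / real K) \<longlonglongrightarrow> 0" for i q r
  proof (cases "q \<ge> 1 \<and> r < q")
    case True
    then show ?thesis using AE_average_residue_dev[of q r, OF _ _ lh] by (simp add: AE_restrict_space_iff)
  qed auto
  then have "AE y in lebesgue. \<forall>i q r. y \<in> {lo i..hi i} \<longrightarrow> q \<ge> 1 \<longrightarrow> r < q \<longrightarrow>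
          (\<lambda>K. (\<Sum>k=1..K. residue_dev q r (y ^ k)) / real K) \<longlonglongrightarrow> 0"
    by (simp only: AE_all_countable) blast
  then show ?thesis
  proof (rule AE_mp[OF _ AE_I2], intro impI allI)
    fix y :: real and q r :: nat
    assume H: "\<forall>i q r. y \<in> {lo i..hi i} \<longrightarrow> q \<ge> 1 \<longrightarrow> r < q \<longrightarrow>
          (\<lambda>K. (\<Sum>k=1..K. residue_dev q r (y ^ k)) / real K) \<longlonglongrightarrow> 0"
      and y: "1 < y" and q: "1 \<le> q" "r < q"
    obtain i :: nat where i: "max y (1 / (y - 1)) < real i" using reals_Archimedean2 by blast
    have "1 / real (Suc i) \<le> y - 1" using i y by (simp add: field_simps)
    then have "y \<in> {lo i..hi i}" using i by (simp add: lo_def hi_def)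
    with H q have "(\<lambda>K. (\<Sum>k=1..K. residue_dev q r (y ^ k)) / real K) \<longlonglongrightarrow> 0" by blast
    then show "(\<lambda>K :: nat. real (card {k :: nat. 1 \<le> k \<and> k \<le> K \<and> [\<lfloor>y ^ k\<rfloor> = int r] (mod int q)})
          - real K / real q) \<in> o[at_top](\<lambda>K. real K)"
      unfolding count_minus_expected_eq_sum_residue_dev
      by (intro smalloI_tendsto eventually_sequentiallyI[of 1]) auto
  qed
qed

end
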